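(* Let $1<p<\infty$ and $0<q<p$. There is a constant $C=C(p,q)$ such that for every complex $M\times N$ matrix $A$, $$\frac1C\, h(A)\le h_{p,q}(A)\le C\, h(A).$$
   Context: Let $(\Omega,\Sigma,\mathbb P)$ be a probability space with a dyadic filtration $(\Sigma_k)_{k\ge0}$ (increasing sub-$\sigma$-algebras, each $\Sigma_k$ atomic with exactly $2^k$ atoms of probability $2^{-k}$). Let $\mathcal E_kf=\mathbb E(f\mid\Sigma_k)$ and $\Delta_kf=\mathcal E_kf-\mathcal E_{k-1}f$ for $k\ge1$. For a complex $M\times N$ matrix $A=(a_{jk})$: $h(A)$ is the least constant such that $\big\|\max_{1\le j\le M}|\sum_{k=1}^N a_{jk}\Delta_kf|\big\|_{L_2}\le h(A)\|f\|_{L_2}$ for all $f\in L_2(\Omega)$; and for $0<q<p<\infty$, $h_{p,q}(A)$ is the least constant such that $\big\|\max_{1\le j\le M}|\sum_{k=1}^N a_{jk}\Delta_kf|\big\|_{L_q}\le h_{p,q}(A)\|f\|_{L_p}$ for all $f\in L_p(\Omega)$. These constants do not depend on the choice of probability space and dyadic filtration. *)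

theory Defs
  imports "HOL-Analysis.Analysis"
begin

text \<open>Canonical model of a dyadic filtration: Omega = [0,1) with Lebesgue measure,
  Sigma_k generated by the 2^k dyadic intervals of length 2^-k.
  (The constants h, h_pq do not depend on the choice of space and filtration.)\<close>

definition dyad_atom :: "nat \<Rightarrow> real \<Rightarrow> real set" where
  "dyad_atom k x = {of_int \<lfloor>x * 2^k\<rfloor> / 2^k ..< (of_int \<lfloor>x * 2^k\<rfloor> + 1) / 2^k}"

definition cond_exp_dyad :: "nat \<Rightarrow> (real \<Rightarrow> complex) \<Rightarrow> real \<Rightarrow> complex" where
  "cond_exp_dyad k f x = of_real (2^k) * (LINT y:dyad_atom k x|lborel. f y)"

definition mart_diff :: "nat \<Rightarrow> (real \<Rightarrow> complex) \<Rightarrow> real \<Rightarrow> complex" where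
  "mart_diff k f x = cond_exp_dyad k f x - cond_exp_dyad (k - 1) f x"

definition in_Lp :: "real \<Rightarrow> (real \<Rightarrow> complex) \<Rightarrow> bool" where
  "in_Lp p f \<longleftrightarrow> f \<in> borel_measurable lborel \<and>
     set_integrable lborel {0..<1} (\<lambda>x. norm (f x) powr p)"

definition Lp_norm :: "real \<Rightarrow> (real \<Rightarrow> complex) \<Rightarrow> real" where
  "Lp_norm p f = (LINT x:{0..<1}|lborel. norm (f x) powr p) powr (1 / p)"

definition max_transform ::
  "nat \<Rightarrow> nat \<Rightarrow> (nat \<Rightarrow> nat \<Rightarrow> complex) \<Rightarrow> (real \<Rightarrow> complex) \<Rightarrow> real \<Rightarrow> complex" where
  "max_transform M N A f x =
     of_real (Max (insert 0 ((\<lambda>j. norm (\<Sum>k=1..N. A j k * mart_diff k f x)) ` {1..M})))"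

definition h_pq :: "real \<Rightarrow> real \<Rightarrow> nat \<Rightarrow> nat \<Rightarrow> (nat \<Rightarrow> nat \<Rightarrow> complex) \<Rightarrow> real" where
  "h_pq p q M N A = Inf {C. 0 \<le> C \<and>
     (\<forall>f. in_Lp p f \<longrightarrow> Lp_norm q (max_transform M N A f) \<le> C * Lp_norm p f)}"

definition h_const :: "nat \<Rightarrow> nat \<Rightarrow> (nat \<Rightarrow> nat \<Rightarrow> complex) \<Rightarrow> real" where
  "h_const M N A = h_pq 2 2 M N A"

end

theory Submission
  imports Defs
begin

text \<open>The sums involve only the conditional expectations up to level \<open>N\<close>, so everything takes place on
  a set of \<open>2^N\<close> points. From the \<open>L\<^sub>p\<close>-\<open>L\<^sub>q\<close> bound \<open>H\<close> only its consequence for functions bounded by 1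
  is kept. A stopping time argument (a Calderon-Zygmund decomposition in which the bad part does not
  leave the stopped blocks) shows that if \<open>\<bar>f\<bar>\<close> has mean at most \<open>a\<close>, then the maximal truncated transform
  exceeds \<open>L * H * a\<close> only with probability \<open>\<eta>\<close>. Repeating a function periodically gives the same
  estimate on every dyadic block. This yields a good-\<open>\<lambda>\<close> inequality against the Doob maximal function,
  hence the \<open>L\<^sub>r\<close> bound with a constant multiple of \<open>H\<close> for every \<open>r > 1\<close>. Taking \<open>r = 2\<close> for the pair
  \<open>(p, q)\<close>, and \<open>r = p\<close> for the pair \<open>(2, 2)\<close>, gives both inequalities.\<close>

section \<open>Block averages\<close>

text \<open>Functions live on all of \<open>nat\<close>, so averaging never leaves the domain; later
  the first block of length \<open>2^N\<close> serves as the probability space.\<close>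

definition bavg :: "nat \<Rightarrow> (nat \<Rightarrow> 'a::real_vector) \<Rightarrow> nat \<Rightarrow> 'a" where
  "bavg n f x = (\<Sum>i<2^n. f (2^n * (x div 2^n) + i)) /\<^sub>R 2^n"

lemma bavg_cong_block: "x div 2^n = y div 2^n \<Longrightarrow> bavg n f x = bavg n f y"
  by (simp add: bavg_def)

lemma bavg_cong:
  assumes "\<And>y. y div 2^n = x div 2^n \<Longrightarrow> f y = g y"
  shows "bavg n f x = bavg n g x"
  unfolding bavg_def using assms by (intro arg_cong2[where f=scaleR] sum.cong refl) auto

lemma bavg_const: "bavg n (\<lambda>_. c) x = c"
  by (simp add: bavg_def scaleR_conv_of_real sum_constant_scaleR)

lemma bavg_0: "bavg 0 f x = f x"
  by (simp add: bavg_def)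

lemma bavg_mono:
  fixes f g :: "nat \<Rightarrow> real"
  assumes "\<And>y. y div 2^n = x div 2^n \<Longrightarrow> f y \<le> g y"
  shows "bavg n f x \<le> bavg n g x"
  unfolding bavg_def using assms by (intro scaleR_left_mono sum_mono) auto

lemma bavg_nonneg: "(\<And>y. 0 \<le> f y) \<Longrightarrow> 0 \<le> (bavg n f x :: real)"
  unfolding bavg_def by (intro scaleR_nonneg_nonneg sum_nonneg) auto

lemma norm_bavg_le: "norm (bavg n f x) \<le> bavg n (\<lambda>y. norm (f y)) x"
  unfolding bavg_def by (simp add: divide_simps norm_sum)

lemma bavg_add: "bavg n (\<lambda>y. f y + g y) x = bavg n f x + bavg n g x"
  by (simp add: bavg_def sum.distrib algebra_simps)

lemma bavg_cmult: "bavg n (\<lambda>y. c * f y) x = c * (bavg n f x :: 'a::real_algebra)"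
  by (simp add: bavg_def sum_distrib_left)

lemma bavg_Suc:
  "bavg (Suc n) f x = (bavg n f (2^Suc n * (x div 2^Suc n)) + bavg n f (2^Suc n * (x div 2^Suc n) + 2^n)) /\<^sub>R 2"
proof -
  define c where "c = 2 ^ Suc n * (x div 2 ^ Suc n)"
  have c1: "2^n * (c div 2^n) = c" "2^n * ((c + 2^n) div 2^n) = c + 2^n"
    by (auto simp: c_def)
  have "{..<2^Suc n} = {..<2^n} \<union> (\<lambda>i. 2^n + i) ` {..<(2::nat)^n}"
  proof -
    have "x \<in> (\<lambda>i. 2^n + i) ` {..<(2::nat)^n}" if "x < 2^Suc n" "\<not> x < 2^n" for x
      using that by (intro image_eqI[of _ _ "x - 2^n"]) auto
    then show ?thesis by auto
  qed
  then have "(\<Sum>i<2^Suc n. f (c + i)) = (\<Sum>i<2^n. f (c + i)) + (\<Sum>i\<in>(\<lambda>i. 2^n + i) ` {..<(2::nat)^n}. f (c + i))"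
    by (simp only:, intro sum.union_disjoint) auto
  also have "(\<Sum>i\<in>(\<lambda>i. 2^n + i) ` {..<(2::nat)^n}. f (c + i)) = (\<Sum>i<2^n. f (c + 2^n + i))"
    by (subst sum.reindex) (auto simp: o_def add_ac)
  finally show ?thesis
    unfolding bavg_def c_def[symmetric] c1 by (simp add: algebra_simps)
qed

lemma bavg_idem: "bavg n (bavg n f) x = bavg n f x"
proof -
  have "bavg n (bavg n f) x = bavg n (\<lambda>_. bavg n f x) x"
    by (intro bavg_cong bavg_cong_block)
  then show ?thesis by (simp add: bavg_const)
qed

text \<open>The tower property for adjacent levels: by \<open>bavg_Suc\<close> only the averages
  over the two halves matter, and averaging again leaves these unchanged.\<close>

lemma bavg_Suc_bavg: "bavg (Suc n) (bavg n f) x = bavg (Suc n) f x"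
  by (simp only: bavg_Suc[of n] bavg_idem)

text \<open>One half of a block carries at most the whole sum of a nonnegative function. This
  regularity of the dyadic filtration is what controls the last step before a stopping time.\<close>

lemma bavg_le_double:
  assumes "\<And>y. 0 \<le> f y"
  shows "bavg n f x \<le> 2 * (bavg (Suc n) f x :: real)"
proof -
  define c where "c = 2 ^ Suc n * (x div 2 ^ Suc n)"
  have 1: "c = 2^n * (2 * (x div 2^n div 2))"
    by (simp add: c_def div_mult2_eq[symmetric] mult_ac)
  have "x div 2^n = c div 2^n \<or> x div 2^n = (c + 2^n) div 2^n"
    unfolding 1 by (cases "even (x div 2^n)") (auto elim!: evenE oddE)
  then have "bavg n f x = bavg n f c \<or> bavg n f x = bavg n f (c + 2^n)"
    by (auto intro: bavg_cong_block)
  moreover have "0 \<le> bavg n f c" "0 \<le> bavg n f (c + 2^n)"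
    using assms by (auto intro: bavg_nonneg)
  ultimately show ?thesis
    unfolding bavg_Suc[of n f x] c_def[symmetric] by auto
qed

text \<open>Reduction modulo \<open>2^s\<close> followed by a shift by a multiple of
  \<open>2^s\<close> carries aligned blocks of length \<open>2^n\<close> onto aligned blocks and
  keeps the offset within them.\<close>

lemma bavg_transplant:
  assumes "n \<le> s"
  shows "bavg n (\<lambda>y. f (2^s * c + y mod 2^s)) y = bavg n f (2^s * c + y mod 2^s)"
proof -
  obtain d where s: "s = n + d" using assms le_Suc_ex by blast
  have m: "y mod 2^s = 2^n * (y div 2^n mod 2^d) + y mod 2^n" for y :: nat
    unfolding s power_add by (rule mod_mult2_eq)
  have 1: "2^s * c + (2^n * (y div 2^n) + i) mod 2^s = 2^n * ((2^s * c + y mod 2^s) div 2^n) + i"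
    if "i < 2^n" for i
  proof -
    have "(2^s * c + y mod 2^s) div 2^n = (2^n * (2^d * c + y div 2^n mod 2^d) + y mod 2^n) div 2^n"
      unfolding m[of y] by (simp add: s power_add algebra_simps)
    also have "\<dots> = 2^d * c + y div 2^n mod 2^d" by simp
    finally have 2: "(2^s * c + y mod 2^s) div 2^n = 2^d * c + y div 2^n mod 2^d" .
    show ?thesis unfolding 2 m[of "2^n * (y div 2^n) + i"]
      using that by (simp add: s power_add algebra_simps)
  qed
  show ?thesis unfolding bavg_def
    by (intro arg_cong2[where f=scaleR] sum.cong refl) (simp add: 1)
qed

section \<open>The dyadic filtration on a finite set\<close>

text \<open>The probability space is \<open>{..<2^N}\<close> with normalised counting measure. The atoms of the
  \<open>k\<close>-th \<open>\<sigma>\<close>-algebra are the blocks of \<open>2^(N - k)\<close> consecutive integers; \<open>sim k x y\<close> means that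
  \<open>x\<close> and \<open>y\<close> lie in the same one. If \<open>P\<close> never occurs, \<open>hit P\<close> is \<open>N\<close>.\<close>

locale dyadic =
  fixes N :: nat
begin

definition E :: "nat \<Rightarrow> (nat \<Rightarrow> 'a::real_vector) \<Rightarrow> nat \<Rightarrow> 'a" where
  "E k = bavg (N - k)"

definition sim :: "nat \<Rightarrow> nat \<Rightarrow> nat \<Rightarrow> bool" where
  "sim k x y \<longleftrightarrow> x div 2^(N - k) = y div 2^(N - k)"

definition adapted :: "(nat \<Rightarrow> nat \<Rightarrow> bool) \<Rightarrow> bool" where
  "adapted P \<longleftrightarrow> (\<forall>k x y. sim k x y \<longrightarrow> P k x = P k y)"

definition hit :: "(nat \<Rightarrow> nat \<Rightarrow> bool) \<Rightarrow> nat \<Rightarrow> nat" where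
  "hit P x = (if \<exists>k\<le>N. P k x then LEAST k. P k x else N)"

text \<open>The conditional expectation of \<open>f\<close> at the stopping time
  \<open>hit P\<close>; for adapted \<open>P\<close> its martingale is that of \<open>f\<close>
  frozen at this time (\<open>E_stopped\<close>).\<close>

definition stopped :: "(nat \<Rightarrow> nat \<Rightarrow> bool) \<Rightarrow> (nat \<Rightarrow> 'a::real_vector) \<Rightarrow> nat \<Rightarrow> 'a" where
  "stopped P f x = E (hit P x) f x"

abbreviation mean :: "(nat \<Rightarrow> real) \<Rightarrow> real" where
  "mean f \<equiv> E 0 f 0"

lemma sim_sym: "sim k x y \<Longrightarrow> sim k y x"
  by (simp add: sim_def)

lemma sim_mono:
  assumes "sim k x y" "j \<le> k"
  shows "sim j x y"
proof -
  have "x div 2^(N - j) = x div 2^(N - k) div 2^((N - j) - (N - k))" for x :: nat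
    using assms(2) by (simp flip: div_mult2_eq power_add del: diff_diff_left add: diff_le_mono2)
  then show ?thesis using assms(1) unfolding sim_def by metis
qed

lemma sim_0: "x < 2^N \<Longrightarrow> y < 2^N \<Longrightarrow> sim 0 x y"
  by (simp add: sim_def)

lemma sim_top: "N \<le> k \<Longrightarrow> sim k x y \<Longrightarrow> x = y"
  by (simp add: sim_def)

lemma E_cong_sim: "sim k x y \<Longrightarrow> E k f x = E k f y"
  by (auto simp: E_def sim_def intro: bavg_cong_block)

lemma E_cong: "(\<And>y. sim k x y \<Longrightarrow> f y = g y) \<Longrightarrow> E k f x = E k g x"
  unfolding E_def sim_def by (rule bavg_cong) simp

lemma E_mono: "(\<And>y. sim k x y \<Longrightarrow> f y \<le> g y) \<Longrightarrow> E k f x \<le> (E k g x :: real)"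
  unfolding E_def sim_def by (rule bavg_mono) simp

lemma E_const: "E k (\<lambda>_. c) x = c"
  by (simp add: E_def bavg_const)

lemma E_eq_const: "(\<And>y. sim k x y \<Longrightarrow> f y = c) \<Longrightarrow> E k f x = c"
  using E_cong[of k x f "\<lambda>_. c"] by (simp add: E_const)

lemma E_nonneg: "(\<And>y. 0 \<le> f y) \<Longrightarrow> 0 \<le> (E k f x :: real)"
  by (simp add: E_def bavg_nonneg)

lemma norm_E_le: "norm (E k f x) \<le> E k (\<lambda>y. norm (f y)) x"
  by (simp add: E_def norm_bavg_le)

lemma E_add: "E k (\<lambda>y. f y + g y) x = E k f x + E k g x"
  by (simp add: E_def bavg_add)

lemma E_cmult: "E k (\<lambda>y. c * f y) x = c * (E k f x :: 'a::real_algebra)"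
  by (simp add: E_def bavg_cmult)

lemma E_top: "N \<le> k \<Longrightarrow> E k f x = f x"
  by (simp add: E_def bavg_0)

lemma E_E_Suc: "k < N \<Longrightarrow> E k (E (Suc k) f) x = E k f x"
  using bavg_Suc_bavg[of "N - Suc k" f x] by (simp add: E_def Suc_diff_Suc)

lemma E_Suc_le_double:
  assumes "\<And>y. 0 \<le> f y"
  shows "E (Suc k) f x \<le> 2 * (E k f x :: real)"
proof (cases "k < N")
  case True
  then show ?thesis
    using bavg_le_double[of f "N - Suc k" x] assms by (simp add: E_def Suc_diff_Suc)
next
  case False
  then show ?thesis using assms[of x] by (simp add: E_top)
qed

lemma mean_eq: "mean f = (\<Sum>x<2^N. f x) / 2^N"
  by (simp add: E_def bavg_def divide_inverse)

lemma mean_mono: "(\<And>x. x < 2^N \<Longrightarrow> f x \<le> g x) \<Longrightarrow> mean f \<le> mean g"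
  unfolding mean_eq by (intro divide_right_mono sum_mono) auto

section \<open>Stopping times and stopped martingales\<close>

lemma hit_le: "hit P x \<le> N"
  unfolding hit_def by (auto intro: Least_le order_trans)

lemma hit_holds:
  assumes "k \<le> N" "P k x"
  shows "P (hit P x) x" "hit P x \<le> k"
  using assms unfolding hit_def by (auto intro: LeastI Least_le)

lemma not_before_hit: "k < hit P x \<Longrightarrow> \<not> P k x"
  using hit_holds(2)[of k P x] hit_le[of P x] by force

text \<open>The stopping time property: up to level \<open>hit P x\<close> an adapted
  \<open>P\<close> cannot tell \<open>x\<close> from a point of the same level-\<open>k\<close>
  block.\<close>

lemma hit_cong:
  assumes P: "adapted P" and s: "sim k x y" and k: "hit P x \<le> k"
  shows "hit P y = hit P x"
proof (cases "\<exists>j\<le>N. P j x")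
  case True
  then have Px: "P (hit P x) x" using hit_holds by blast
  have eq: "P j x = P j y" if "j \<le> hit P x" for j
    using P sim_mono[OF s, of j] k that unfolding adapted_def by auto
  have le: "hit P y \<le> hit P x"
    using hit_holds(2)[of "hit P x" P y] eq Px hit_le by auto
  have "P (hit P y) y"
    using hit_holds(1)[of "hit P x" P y] eq Px hit_le by auto
  then have "P (hit P y) x" using eq le by auto
  then have "hit P x \<le> hit P y"
    using hit_holds(2)[of "hit P y" P x] hit_le by auto
  with le show ?thesis by simp
next
  case False
  then have "hit P x = N" unfolding hit_def by auto
  \<comment> \<open>Now \<open>N \<le> k\<close>, and blocks at such levels are single
    points.\<close>
  then show ?thesis using s k sim_top by auto
qed

lemma E_stopped_after:
  assumes P: "adapted P" and k: "hit P x \<le> k"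
  shows "E k (stopped P f) x = E (hit P x) f x"
proof (rule E_eq_const)
  fix y assume s: "sim k x y"
  have "hit P y = hit P x" using hit_cong[OF P s k] .
  then show "stopped P f y = E (hit P x) f x"
    using E_cong_sim[OF sim_mono[OF s k], of f] by (simp add: stopped_def)
qed

text \<open>Downward induction from \<open>N\<close>. If the block of \<open>x\<close> is not
  stopped at level \<open>k\<close>, all its points are stopped later, and the tower property passes
  to level \<open>k + 1\<close>; if it is, \<open>E_stopped_after\<close> applies.\<close>

lemma E_stopped_before:
  assumes P: "adapted P" and k: "k \<le> hit P x"
  shows "E k (stopped P f) x = E k f x"
proof -
  have "k \<le> N" using k hit_le le_trans by blast
  then show ?thesis using k
  proof (induction arbitrary: x rule: inc_induct)
    case base
    then have "hit P x = N" using hit_le[of P x] by simp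
    then show ?case using E_stopped_after[OF P, of x N] by simp
  next
    case (step k)
    show ?case
    proof (cases "hit P x = k")
      case True
      then show ?thesis using E_stopped_after[OF P, of x k] by simp
    next
      case False
      have "E k (stopped P f) x = E k (E (Suc k) (stopped P f)) x"
        using step.hyps E_E_Suc by metis
      also have "\<dots> = E k (E (Suc k) f) x"
      proof (rule E_cong, rule step.IH)
        fix y assume s: "sim k x y"
        show "Suc k \<le> hit P y"
        proof (rule ccontr)
          assume "\<not> Suc k \<le> hit P y"
          then have "hit P x = hit P y" using hit_cong[OF P sim_sym[OF s]] by simp
          then show False using False step.prems \<open>\<not> Suc k \<le> hit P y\<close> by simp
        qed
      qed
      also have "\<dots> = E k f x" using step.hyps E_E_Suc by metis
      finally show ?thesis .
    qed
  qed
qed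

lemma E_stopped: "adapted P \<Longrightarrow> E k (stopped P f) x = E (min k (hit P x)) f x"
  using E_stopped_after E_stopped_before by (metis min.orderE min.commute nle_le)

lemma mean_stopped: "adapted P \<Longrightarrow> mean (stopped P f) = mean f"
  by (simp add: E_stopped)

lemma stopped_if_no_hit: "(\<And>k. k \<le> N \<Longrightarrow> \<not> P k x) \<Longrightarrow> stopped P f x = f x"
  by (auto simp: stopped_def hit_def E_top)

text \<open>Copies the level-\<open>m\<close> block around \<open>x\<close> onto every other level-\<open>m\<close> block. Since the
  coefficients of the transform depend on the level only, this turns global estimates into
  estimates on the block.\<close>

definition transplant :: "nat \<Rightarrow> nat \<Rightarrow> nat \<Rightarrow> nat" where
  "transplant m x y = 2^(N - m) * (x div 2^(N - m)) + y mod 2^(N - m)"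

lemma sim_transplant: "sim m x (transplant m x y)"
  by (simp add: sim_def transplant_def)

lemma E_transplant_ge:
  assumes "m \<le> k"
  shows "E k (\<lambda>y. f (transplant m x y)) y = E k f (transplant m x y)"
  unfolding E_def transplant_def using assms by (intro bavg_transplant) simp

text \<open>All level-\<open>m\<close> blocks of the copy have the same average, so coarser averages
  are constant. Hence the copy has no martingale differences up to level \<open>m\<close>.\<close>

lemma E_transplant_le:
  assumes "k \<le> m" "m \<le> N"
  shows "E k (\<lambda>y. f (transplant m x y)) y = E m f x"
  using assms(1)
proof (induction arbitrary: y rule: inc_induct)
  case base
  then show ?case
    using E_transplant_ge[of m m f x y] E_cong_sim[OF sim_transplant, of m f x y] by simp
next
  case (step k)
  have "E k (\<lambda>y. f (transplant m x y)) y = E k (E (Suc k) (\<lambda>y. f (transplant m x y))) y"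
    using step.hyps assms(2) by (simp add: E_E_Suc)
  also have "\<dots> = E m f x"
    by (rule E_eq_const) (rule step.IH)
  finally show ?case .
qed

end

section \<open>Doob's maximal inequality\<close>

context dyadic
begin

definition emax :: "(nat \<Rightarrow> real) \<Rightarrow> nat \<Rightarrow> real" where
  "emax g x = Max ((\<lambda>n. E n g x) ` {..N})"

lemma less_emax_iff: "c < emax g x \<longleftrightarrow> (\<exists>n\<le>N. c < E n g x)"
  unfolding emax_def by (subst Max_gr_iff) auto

lemma E_le_emax: "n \<le> N \<Longrightarrow> E n g x \<le> emax g x"
  unfolding emax_def by (rule Max_ge) auto

lemma adapted_E: "adapted (\<lambda>k x. c < E k g x)"
  unfolding adapted_def using E_cong_sim by metis

text \<open>Stop when an average first exceeds \<open>c\<close>: the stopped function exceeds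
  \<open>c\<close> wherever \<open>emax g\<close> does, and stopping preserves the mean.\<close>

lemma emax_weak_type:
  assumes g: "\<And>x. 0 \<le> g x" and c: "0 < c"
  shows "c * mean (\<lambda>x. of_bool (c < emax g x)) \<le> mean g"
proof -
  have "mean (\<lambda>x. c * of_bool (c < emax g x)) \<le> mean (stopped (\<lambda>k x. c < E k g x) g)"
  proof (rule mean_mono)
    fix x
    show "c * of_bool (c < emax g x) \<le> stopped (\<lambda>k x. c < E k g x) g x"
    proof (cases "\<exists>n\<le>N. c < E n g x")
      case True
      then have "c < E (hit (\<lambda>k x. c < E k g x) x) g x"
        using hit_holds(1)[of _ "\<lambda>k x. c < E k g x"] by blast
      then show ?thesis using c by (auto simp: stopped_def)
    next
      case False
      then have "\<not> c < emax g x" by (simp add: less_emax_iff)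
      then show ?thesis by (simp add: stopped_def E_nonneg g)
    qed
  qed
  then show ?thesis by (simp add: E_cmult mean_stopped adapted_E)
qed

end

section \<open>Layer-cake integration of inequalities between level sets\<close>

lemma powr_tail_has_integral:
  fixes s v :: real
  assumes "0 < s" "0 \<le> v"
  shows "((\<lambda>t. if 0 < t \<and> t < v then t powr (s - 1) else 0) has_integral (v powr s / s)) UNIV"
proof -
  have "((\<lambda>t. t powr (s - 1)) has_integral (v powr s / s)) {0..v}"
    using has_integral_powr_from_0[of "s - 1" v] assms by simp
  then have "((\<lambda>t. if t \<in> {0..v} then t powr (s - 1) else 0) has_integral (v powr s / s)) UNIV"
    by (simp only: has_integral_restrict_UNIV)
  then show ?thesis
    by (rule has_integral_spike_finite[where S="{0,v}", rotated 2]) auto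
qed

text \<open>Integrate the hypothesis against \<open>t powr (r - 1)\<close> over positive
  \<open>t\<close>; the sums are finite, so linearity moves the integral inside.\<close>

lemma layer_cake_good_lambda:
  assumes "finite S" and r: "0 < r"
    and nn: "\<And>x. 0 \<le> a x" "\<And>x. 0 \<le> b x" "\<And>x. 0 \<le> c x"
    and le: "\<And>t. 0 < t \<Longrightarrow> (\<Sum>x\<in>S. of_bool (t < a x)) \<le> e * (\<Sum>x\<in>S. of_bool (t < b x)) + (\<Sum>x\<in>S. of_bool (t < c x))"
  shows "(\<Sum>x\<in>S. a x powr r) \<le> e * (\<Sum>x\<in>S. b x powr r) + (\<Sum>x\<in>S. c x powr (r::real))"
proof -
  define F where "F v t = (if 0 < t \<and> t < v then t powr (r - 1) else 0)" for v t :: real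
  have F: "(F v has_integral v powr r / r) UNIV" if "0 \<le> v" for v
    unfolding F_def using powr_tail_has_integral[OF r that] .
  have F': "F v t = (if 0 < t then t powr (r - 1) * of_bool (t < v) else 0)" for v t
    by (auto simp: F_def)
  have "(\<Sum>x\<in>S. a x powr r / r) \<le> e * (\<Sum>x\<in>S. b x powr r / r) + (\<Sum>x\<in>S. c x powr r / r)"
  proof (rule has_integral_le)
    show "((\<lambda>t. \<Sum>x\<in>S. F (a x) t) has_integral (\<Sum>x\<in>S. a x powr r / r)) UNIV"
      by (intro has_integral_sum F assms)
    show "((\<lambda>t. e * (\<Sum>x\<in>S. F (b x) t) + (\<Sum>x\<in>S. F (c x) t)) has_integral
        (e * (\<Sum>x\<in>S. b x powr r / r) + (\<Sum>x\<in>S. c x powr r / r))) UNIV"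
      by (intro has_integral_add has_integral_mult_right has_integral_sum F assms)
    fix t :: real
    show "(\<Sum>x\<in>S. F (a x) t) \<le> e * (\<Sum>x\<in>S. F (b x) t) + (\<Sum>x\<in>S. F (c x) t)"
    proof (cases "0 < t")
      case True
      from mult_left_mono[OF le[OF True], of "t powr (r - 1)"] True show ?thesis
        by (simp add: F' distrib_left mult.left_commute flip: sum_distrib_left)
    qed (simp add: F')
  qed
  then show ?thesis using r by (simp add: divide_simps flip: sum_divide_distrib)
qed

text \<open>The factor \<open>t\<close> on the left lowers the weight on the right to
  \<open>t powr (r - 2)\<close>, which is integrable at 0 because \<open>1 < r\<close> and produces
  the denominator \<open>r - 1\<close>.\<close>

lemma layer_cake_doob:
  assumes "finite S" and r: "1 < r"
    and nn: "\<And>x. 0 \<le> a x" "\<And>x. 0 \<le> b x"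
    and le: "\<And>t. 0 < t \<Longrightarrow> t * (\<Sum>x\<in>S. of_bool (t < a x)) \<le> (\<Sum>x\<in>S. b x * of_bool (t < b x))"
  shows "(\<Sum>x\<in>S. a x powr r) \<le> r / (r - 1) * (\<Sum>x\<in>S. b x powr (r::real))"
proof -
  define F where "F s v t = (if 0 < t \<and> t < v then t powr (s - 1) else 0)" for s v t :: real
  have F: "(F s v has_integral v powr s / s) UNIV" if "0 < s" "0 \<le> v" for s v
    unfolding F_def using powr_tail_has_integral that .
  have F': "F s v t = (if 0 < t then t powr (s - 1) * of_bool (t < v) else 0)" for s v t
    by (auto simp: F_def)
  have "(\<Sum>x\<in>S. a x powr r / r) \<le> (\<Sum>x\<in>S. b x * (b x powr (r - 1) / (r - 1)))"
  proof (rule has_integral_le)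
    show "((\<lambda>t. \<Sum>x\<in>S. F r (a x) t) has_integral (\<Sum>x\<in>S. a x powr r / r)) UNIV"
      using r by (intro has_integral_sum F assms) auto
    show "((\<lambda>t. \<Sum>x\<in>S. b x * F (r - 1) (b x) t) has_integral
        (\<Sum>x\<in>S. b x * (b x powr (r - 1) / (r - 1)))) UNIV"
      using r by (intro has_integral_mult_right has_integral_sum F assms) auto
    fix t :: real
    show "(\<Sum>x\<in>S. F r (a x) t) \<le> (\<Sum>x\<in>S. b x * F (r - 1) (b x) t)"
    proof (cases "0 < t")
      case True
      have "t powr (r - 1) = t powr (r - 2) * t"
        using True powr_add[of t "r - 2" 1] by simp
      then have "(\<Sum>x\<in>S. F r (a x) t) = t powr (r - 2) * (t * (\<Sum>x\<in>S. of_bool (t < a x)))"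
        using True by (simp add: F' sum_distrib_left mult_ac)
      also have "\<dots> \<le> t powr (r - 2) * (\<Sum>x\<in>S. b x * of_bool (t < b x))"
        by (rule mult_left_mono[OF le[OF True]]) simp
      also have "\<dots> = (\<Sum>x\<in>S. b x * F (r - 1) (b x) t)"
        using True by (simp add: F' sum_distrib_left mult_ac)
      finally show ?thesis .
    qed (simp add: F')
  qed
  also have "\<dots> = (\<Sum>x\<in>S. b x powr r) / (r - 1)"
    unfolding sum_divide_distrib
  proof (rule sum.cong)
    fix x
    show "b x * (b x powr (r - 1) / (r - 1)) = b x powr r / (r - 1)"
      using nn(2)[of x] powr_add[of "b x" 1 "r - 1"] by (cases "b x = 0") auto
  qed simp
  finally show ?thesis using r by (simp add: field_simps flip: sum_divide_distrib)
qed

text \<open>Cutting \<open>g\<close> at height \<open>t\<close> lowers its averages by at most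
  \<open>t\<close>, so \<open>2 * t < emax g x\<close> forces \<open>t < emax h x\<close> for the
  part \<open>h\<close> of \<open>g\<close> above \<open>t\<close>. The weak type bound for
  \<open>h\<close> feeds \<open>layer_cake_doob\<close>; halving \<open>emax g\<close> costs
  \<open>2 powr r\<close>.\<close>

lemma (in dyadic) emax_strong_type:
  assumes g: "\<And>x. 0 \<le> g x" and r: "1 < r"
  shows "mean (\<lambda>x. emax g x powr r) \<le> 2 powr r * (r / (r - 1)) * mean (\<lambda>x. g x powr r)"
proof -
  have e0: "0 \<le> emax g x" for x
    using E_le_emax[of 0 g x] E_nonneg[of g 0 x] g by simp
  have "(\<Sum>x<2^N. (emax g x / 2) powr r) \<le> r / (r - 1) * (\<Sum>x<2^N. g x powr r)"
  proof (rule layer_cake_doob)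
    fix t :: real assume t: "0 < t"
    define h where "h x = g x * of_bool (t < g x)" for x
    have h: "t < emax h x" if "t < emax g x / 2" for x
    proof -
      from that have "2 * t < emax g x" by simp
      then obtain n where n: "n \<le> N" "2 * t < E n g x" by (auto simp: less_emax_iff)
      have "E n g x \<le> E n (\<lambda>x. h x + t) x"
        by (rule E_mono) (use t in \<open>auto simp: h_def\<close>)
      also have "\<dots> = E n h x + t" by (simp add: E_add E_const)
      finally show ?thesis using n by (auto simp: less_emax_iff)
    qed
    have "t * mean (\<lambda>x. of_bool (t < emax g x / 2)) \<le> t * mean (\<lambda>x. of_bool (t < emax h x))"
      by (intro mult_left_mono mean_mono) (use h t in auto)
    also have "\<dots> \<le> mean h"
      by (rule emax_weak_type) (use g t in \<open>auto simp: h_def\<close>)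
    finally show "t * (\<Sum>x<2^N. of_bool (t < emax g x / 2)) \<le> (\<Sum>x<2^N. g x * of_bool (t < g x))"
      by (simp add: mean_eq h_def divide_simps)
  qed (use e0 g r in auto)
  then have "(\<Sum>x<2^N. emax g x powr r) \<le> 2 powr r * (r / (r - 1)) * (\<Sum>x<2^N. g x powr r)"
    using e0 by (simp add: powr_divide field_simps flip: sum_divide_distrib)
  then show ?thesis
    unfolding mean_eq using divide_right_mono[of _ _ "2^N"] by fastforce
qed

section \<open>Maximal matrix transforms\<close>

locale matrix_transform = dyadic N for N :: nat +
  fixes M :: nat and A :: "nat \<Rightarrow> nat \<Rightarrow> complex"
begin

text \<open>The inserted \<open>0\<close> makes the value \<open>0\<close> when
  \<open>M = 0\<close>, as in \<open>max_transform\<close>.\<close>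

definition supn :: "(nat \<Rightarrow> complex) \<Rightarrow> real" where
  "supn v = Max (insert 0 ((\<lambda>j. norm (v j)) ` {1..M}))"

definition D :: "nat \<Rightarrow> (nat \<Rightarrow> complex) \<Rightarrow> nat \<Rightarrow> complex" where
  "D k f x = E k f x - E (k - 1) f x"

text \<open>The lower cut \<open>a\<close> serves the estimates inside a block, where only levels
  finer than that of the block act.\<close>

definition tr :: "nat \<Rightarrow> nat \<Rightarrow> (nat \<Rightarrow> complex) \<Rightarrow> nat \<Rightarrow> real" where
  "tr a b f x = supn (\<lambda>j. \<Sum>k\<in>{a<..b}. A j k * D k f x)"

lemma supn_nonneg: "0 \<le> supn v"
  unfolding supn_def by (rule Max_ge) auto

lemma norm_le_supn: "j \<in> {1..M} \<Longrightarrow> norm (v j) \<le> supn v"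
  unfolding supn_def by (rule Max_ge) auto

lemma supn_le_iff: "0 \<le> c \<Longrightarrow> supn v \<le> c \<longleftrightarrow> (\<forall>j\<in>{1..M}. norm (v j) \<le> c)"
  unfolding supn_def by (subst Max_le_iff) auto

lemma supn_add: "supn (\<lambda>j. u j + v j) \<le> supn u + supn v"
  by (auto simp: supn_le_iff add_nonneg_nonneg supn_nonneg
      intro!: order_trans[OF norm_triangle_ineq] add_mono norm_le_supn)

lemma tr_nonneg: "0 \<le> tr a b f x"
  by (simp add: tr_def supn_nonneg)

lemma tr_refl: "tr a a f x = 0"
  by (auto simp: tr_def supn_def image_constant_conv)

lemma tr_triangle:
  assumes "a \<le> b" "b \<le> c"
  shows "tr a c f x \<le> tr a b f x + tr b c f x"
proof -
  have "{a<..c} = {a<..b} \<union> {b<..c}" using assms by auto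
  then have "tr a c f x = supn (\<lambda>j. (\<Sum>k\<in>{a<..b}. A j k * D k f x) + (\<Sum>k\<in>{b<..c}. A j k * D k f x))"
    unfolding tr_def by (simp only:, subst sum.union_disjoint) auto
  then show ?thesis unfolding tr_def using supn_add by simp
qed

lemma tr_cong_sim:
  assumes "sim b x y"
  shows "tr a b f x = tr a b f y"
proof -
  have "D k f x = D k f y" if "k \<le> b" for k
    using E_cong_sim[OF sim_mono[OF assms], of k f] E_cong_sim[OF sim_mono[OF assms], of "k-1" f] that
    by (simp add: D_def)
  then show ?thesis by (simp add: tr_def)
qed

text \<open>The differences of the stopped martingale vanish after \<open>hit P x\<close>, so
  stopping the function truncates the transform.\<close>

lemma tr_stopped:
  assumes "adapted P"
  shows "tr 0 N (stopped P f) x = tr 0 (hit P x) f x"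
proof -
  have D: "D k (stopped P f) x = (if k \<le> hit P x then D k f x else 0)" for k
    by (cases "k \<le> hit P x") (simp_all add: D_def E_stopped[OF assms] min_absorb1 min_absorb2)
  have "(\<Sum>k\<in>{0<..N}. A j k * D k (stopped P f) x) = (\<Sum>k\<in>{0<..hit P x}. A j k * D k f x)" for j
    using hit_le[of P x] by (intro sum.mono_neutral_cong_right) (auto simp: D)
  then show ?thesis by (simp add: tr_def)
qed

text \<open>The copy has no differences up to level \<open>m\<close> and reproduces those above it,
  while the coefficients do not depend on the point.\<close>

lemma tr_transplant:
  assumes "m \<le> n" "m \<le> N"
  shows "tr 0 n (\<lambda>y. f (transplant m x y)) y = tr m n f (transplant m x y)"
proof -
  have "D k (\<lambda>y. f (transplant m x y)) y = (if m < k then D k f (transplant m x y) else 0)" for k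
    using assms(2) by (auto simp: D_def E_transplant_ge E_transplant_le)
  then have "(\<Sum>k\<in>{0<..n}. A j k * D k (\<lambda>y. f (transplant m x y)) y) =
      (\<Sum>k\<in>{m<..n}. A j k * D k f (transplant m x y))" for j
    by (intro sum.mono_neutral_cong_right) auto
  then show ?thesis by (simp add: tr_def)
qed

definition tr_max :: "nat \<Rightarrow> (nat \<Rightarrow> complex) \<Rightarrow> nat \<Rightarrow> real" where
  "tr_max m f x = Max ((\<lambda>n. tr m n f x) ` {m..N})"

lemma less_tr_max_iff: "m \<le> N \<Longrightarrow> c < tr_max m f x \<longleftrightarrow> (\<exists>n\<in>{m..N}. c < tr m n f x)"
  unfolding tr_max_def by (subst Max_gr_iff) auto

lemma tr_le_tr_max: "tr 0 N f x \<le> tr_max 0 f x"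
  unfolding tr_max_def by (rule Max_ge) auto

end

section \<open>Extrapolation from bounded functions to all exponents above 1\<close>

context matrix_transform
begin

lemma supn_cmult_le: "supn (\<lambda>j. c * v j) \<le> norm c * supn v"
  by (auto simp: supn_le_iff supn_nonneg norm_mult intro!: mult_left_mono norm_le_supn)

lemma tr_cmult_le: "tr a b (\<lambda>x. c * f x) x \<le> norm c * tr a b f x"
proof -
  have "(\<Sum>k\<in>{a<..b}. A j k * D k (\<lambda>x. c * f x) x) = c * (\<Sum>k\<in>{a<..b}. A j k * D k f x)" for j
    by (simp add: D_def E_cmult sum_distrib_left algebra_simps)
  then show ?thesis unfolding tr_def using supn_cmult_le by simp
qed

lemma tr_max_nonneg: "m \<le> N \<Longrightarrow> 0 \<le> tr_max m f x"
  unfolding tr_max_def by (rule order_trans[OF tr_nonneg Max_ge]) auto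

text \<open>A bound from L_infinity to L_q. The exponent \<open>p\<close> does not occur in it,
  which is what allows a change of exponent.\<close>

definition unif_bounded :: "real \<Rightarrow> real \<Rightarrow> bool" where
  "unif_bounded q H \<longleftrightarrow>
     (\<forall>f. (\<forall>x<2^N. norm (f x) \<le> 1) \<longrightarrow> mean (\<lambda>x. tr 0 N f x powr q) \<le> H powr q)"

text \<open>Stopping when the transform exceeds \<open>t\<close> or the averages of \<open>\<bar>f\<bar>\<close> exceed \<open>\<alpha>\<close> leaves a
  function bounded by \<open>2 * \<alpha>\<close>, so a bound for bounded functions is all that is needed.\<close>

lemma weak_type_tr_max:
  assumes H: "unif_bounded q H" "0 < H" and q: "0 < q"
    and \<eta>: "0 < \<eta>" "\<eta> \<le> 1" and L: "L = 4 / \<eta> * (2 / \<eta>) powr (1 / q)"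
    and a: "0 < a" "mean (\<lambda>x. norm (f x)) \<le> a"
  shows "mean (\<lambda>x. of_bool (L * H * a < tr_max 0 f x)) \<le> \<eta>"
proof -
  \<comment> \<open>With this height the averages exceed \<open>\<alpha>\<close> with probability at
    most \<open>\<eta> / 2\<close>; the other half is left for the transform.\<close>
  define \<alpha> where "\<alpha> = 2 * a / \<eta>"
  define t where "t = L * H * a"
  have Lp: "0 < L" using \<eta> L by simp
  have t: "0 < t" using Lp H a by (simp add: t_def)
  have \<alpha>: "0 < \<alpha>" "a \<le> \<alpha>" using a \<eta> by (auto simp: \<alpha>_def field_simps)
  define P where "P n x \<longleftrightarrow> t < tr 0 n f x \<or> \<alpha> < E n (\<lambda>x. norm (f x)) x" for n x
  have P: "adapted P"
    unfolding adapted_def P_def using tr_cong_sim E_cong_sim by metis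
  define g where "g = stopped P f"
  have g_le: "norm (g x) \<le> 2 * \<alpha>" if "x < 2^N" for x
  proof -
    have "norm (g x) \<le> E (hit P x) (\<lambda>x. norm (f x)) x"
      unfolding g_def stopped_def by (rule norm_E_le)
    also have "\<dots> \<le> 2 * \<alpha>"
    \<comment> \<open>Stopping at level 0 leaves the mean, at most \<open>a\<close>. Otherwise the
      parent block was not stopped, its average is at most \<open>\<alpha>\<close>, and halving the
      block at most doubles it.\<close>
    proof (cases "hit P x")
      case 0
      have "E 0 (\<lambda>x. norm (f x)) x = mean (\<lambda>x. norm (f x))"
        using that by (intro E_cong_sim sim_0) auto
      then show ?thesis using 0 a \<alpha> by simp
    next
      case (Suc n)
      have "E (Suc n) (\<lambda>x. norm (f x)) x \<le> 2 * E n (\<lambda>x. norm (f x)) x"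
        by (rule E_Suc_le_double) simp
      also have "E n (\<lambda>x. norm (f x)) x \<le> \<alpha>"
        using not_before_hit[of n P x] Suc by (simp add: P_def)
      finally show ?thesis using Suc by simp
    qed
    finally show ?thesis .
  qed
  define g' where "g' x = complex_of_real (1 / (2 * \<alpha>)) * g x" for x
  have g: "g = (\<lambda>x. complex_of_real (2 * \<alpha>) * g' x)" using \<alpha> by (auto simp: g'_def)
  have "norm (g' x) \<le> 1" if "x < 2^N" for x
    using g_le[OF that] \<alpha> by (simp add: g'_def norm_mult norm_divide divide_simps)
  then have Hg': "mean (\<lambda>x. tr 0 N g' x powr q) \<le> H powr q"
    using H by (auto simp: unif_bounded_def)
  \<comment> \<open>Where all averages stay below \<open>\<alpha>\<close>, only the transform can
    have caused the stop, so the transform of \<open>g\<close> exceeds \<open>t\<close>; the last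
    term is Chebyshev's inequality with exponent \<open>q\<close>.\<close>
  have pt: "of_bool (t < tr_max 0 f x) \<le>
      of_bool (\<alpha> < emax (\<lambda>x. norm (f x)) x) + (2 * \<alpha> / t) powr q * tr 0 N g' x powr q" for x
  proof (cases "t < tr_max 0 f x \<and> \<not> \<alpha> < emax (\<lambda>x. norm (f x)) x")
    case True
    then obtain n where n: "n \<le> N" "t < tr 0 n f x" by (auto simp: less_tr_max_iff)
    then have "P (hit P x) x" using hit_holds(1)[of n P x] by (simp add: P_def)
    moreover have "\<not> \<alpha> < E (hit P x) (\<lambda>x. norm (f x)) x"
      using True hit_le[of P x] by (auto simp: less_emax_iff)
    ultimately have "t < tr 0 N g x"
      unfolding g_def tr_stopped[OF P] by (simp add: P_def)
    also have "\<dots> \<le> 2 * \<alpha> * tr 0 N g' x"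
      unfolding g using tr_cmult_le[of 0 N "complex_of_real (2 * \<alpha>)" g' x] \<alpha> by (simp add: norm_mult)
    finally have "1 \<le> 2 * \<alpha> / t * tr 0 N g' x" using t by (simp add: field_simps)
    then have "1 \<le> (2 * \<alpha> / t * tr 0 N g' x) powr q"
      using q by (intro ge_one_powr_ge_zero) auto
    also have "\<dots> = (2 * \<alpha> / t) powr q * tr 0 N g' x powr q"
      by (intro powr_mult)
    finally show ?thesis by simp
  qed auto
  have "mean (\<lambda>x. of_bool (t < tr_max 0 f x)) \<le>
      mean (\<lambda>x. of_bool (\<alpha> < emax (\<lambda>x. norm (f x)) x) + (2 * \<alpha> / t) powr q * tr 0 N g' x powr q)"
    by (rule mean_mono) (rule pt)
  also have "\<dots> = mean (\<lambda>x. of_bool (\<alpha> < emax (\<lambda>x. norm (f x)) x)) +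
      (2 * \<alpha> / t) powr q * mean (\<lambda>x. tr 0 N g' x powr q)"
    by (simp add: E_add E_cmult)
  also have "\<dots> \<le> \<eta> / 2 + \<eta> / 2"
  proof (rule add_mono)
    have "\<alpha> * mean (\<lambda>x. of_bool (\<alpha> < emax (\<lambda>x. norm (f x)) x)) \<le> a"
      using emax_weak_type[of "\<lambda>x. norm (f x)" \<alpha>] \<alpha> a by simp
    then show "mean (\<lambda>x. of_bool (\<alpha> < emax (\<lambda>x. norm (f x)) x)) \<le> \<eta> / 2"
      using a \<eta> by (simp add: \<alpha>_def field_simps)
    have "(2 * \<alpha> / t) powr q * mean (\<lambda>x. tr 0 N g' x powr q) \<le> (2 * \<alpha> / t) powr q * H powr q"
      by (intro mult_left_mono Hg') simp
    also have "\<dots> = (2 * \<alpha> / t * H) powr q"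
      by (intro powr_mult[symmetric])
    \<comment> \<open>The value of \<open>L\<close> is chosen to make the \<open>q\<close>-th power
      of this quotient equal to \<open>\<eta> / 2\<close>.\<close>
    also have "2 * \<alpha> / t * H = 4 / \<eta> / L"
      using a H by (simp add: \<alpha>_def t_def)
    also have "\<dots> = (\<eta> / 2) powr (1 / q)"
      using \<eta> q powr_minus_divide[of "\<eta> / 2" "1/q"] by (simp add: L powr_divide)
    also have "\<dots> powr q = \<eta> / 2" using \<eta> q by (simp add: powr_powr)
    finally show "(2 * \<alpha> / t) powr q * mean (\<lambda>x. tr 0 N g' x powr q) \<le> \<eta> / 2" .
  qed
  finally show ?thesis by (simp add: t_def)
qed

text \<open>Apply the global estimate to the copy of the block: its mean is the block average, and
  its transform is the one restarted at level \<open>m\<close>.\<close>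

lemma local_weak_type_tr_max:
  assumes H: "unif_bounded q H" "0 < H" and q: "0 < q"
    and \<eta>: "0 < \<eta>" "\<eta> \<le> 1" and L: "L = 4 / \<eta> * (2 / \<eta>) powr (1 / q)"
    and a: "0 < a" and m: "m \<le> N" and le: "E m (\<lambda>x. norm (f x)) x \<le> a"
  shows "E m (\<lambda>x. of_bool (L * H * a < tr_max m f x)) x \<le> \<eta>"
proof -
  define f' where "f' y = f (transplant m x y)" for y
  have f': "mean (\<lambda>y. norm (f' y)) \<le> a"
    using le E_transplant_le[of 0 m "\<lambda>x. norm (f x)" x 0] m by (simp add: f'_def)
  have "E m (\<lambda>x. of_bool (L * H * a < tr_max m f x)) x =
      mean (\<lambda>y. of_bool (L * H * a < tr_max m f (transplant m x y)))"
    using E_transplant_le[of 0 m "\<lambda>x. of_bool (L * H * a < tr_max m f x) :: real" x 0] m by simp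
  also have "\<dots> \<le> mean (\<lambda>y. of_bool (L * H * a < tr_max 0 f' y))"
  proof (rule mean_mono)
    fix y
    have "L * H * a < tr_max 0 f' y" if gt: "L * H * a < tr_max m f (transplant m x y)"
    proof -
      obtain n where n: "m \<le> n" "n \<le> N" "L * H * a < tr m n f (transplant m x y)"
        using gt m by (auto simp: less_tr_max_iff)
      then show ?thesis
        using tr_transplant[OF n(1) m, of f x y]
        unfolding f'_def[abs_def] by (auto simp: less_tr_max_iff intro!: bexI[of _ n])
    qed
    then show "of_bool (L * H * a < tr_max m f (transplant m x y)) \<le>
      (of_bool (L * H * a < tr_max 0 f' y) :: real)" by simp
  qed
  also have "\<dots> \<le> \<eta>"
    by (rule weak_type_tr_max[OF H q \<eta> L a f'])
  finally show ?thesis .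
qed

text \<open>The local estimate is applied on the parent of each maximal block where the partial
  transform exceeds \<open>t\<close>; this avoids any estimate of the jump at the stopping time.\<close>

lemma good_lambda:
  assumes H: "unif_bounded q H" "0 < H" and q: "0 < q"
    and \<eta>: "0 < \<eta>" "\<eta> \<le> 1" and L: "L = 4 / \<eta> * (2 / \<eta>) powr (1 / q)"
    and t: "0 < t"
  shows "mean (\<lambda>x. of_bool (2 * t < tr_max 0 f x)) \<le>
     2 * \<eta> * mean (\<lambda>x. of_bool (t < tr_max 0 f x)) +
     mean (\<lambda>x. of_bool (t < L * H * emax (\<lambda>x. norm (f x)) x))"
proof -
  have Lp: "0 < L" using \<eta> L by simp
  \<comment> \<open>Calibrated so that the local estimate has threshold exactly
    \<open>t\<close>.\<close>
  define a where "a = t / (L * H)"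
  have a: "0 < a" and LHa: "L * H * a = t" using Lp H t by (auto simp: a_def)
  \<comment> \<open>The part of the event where the Doob maximal function is small; the rest is
    covered by the last term of the claim.\<close>
  define G where "G x \<longleftrightarrow> 2 * t < tr_max 0 f x \<and> \<not> a < emax (\<lambda>x. norm (f x)) x" for x
  define P where "P n x \<longleftrightarrow> t < tr 0 n f x" for n x
  have P: "adapted P"
    unfolding adapted_def P_def using tr_cong_sim by metis
  \<comment> \<open>Stopping keeps the mean, so it suffices to bound the proportion of
    \<open>G\<close> in each stopped block.\<close>
  have pt: "stopped P (\<lambda>x. of_bool (G x)) x \<le> 2 * \<eta> * of_bool (t < tr_max 0 f x)" for x
  proof (cases "\<exists>n\<le>N. P n x")
    case False
    then have "\<not> t < tr_max 0 f x" by (auto simp: less_tr_max_iff P_def)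
    moreover have "stopped P (\<lambda>x. of_bool (G x)) x = (of_bool (G x) :: real)"
      using False by (intro stopped_if_no_hit) auto
    ultimately show ?thesis using t by (auto simp: G_def)
  next
    case True
    then have "P (hit P x) x" using hit_holds(1) by blast
    \<comment> \<open>The transform over no levels is \<open>0\<close>, so stopping never occurs at
      level 0 and a parent level \<open>k\<close> exists.\<close>
    then obtain k where k: "hit P x = Suc k"
      using t by (cases "hit P x") (auto simp: P_def tr_refl)
    have kN: "Suc k \<le> N" using hit_le[of P x] k by simp
    have Pk: "\<not> P j z" if "j \<le> k" "sim k x z" for j z
    proof -
      have "\<not> P j x" using not_before_hit[of j P x] k that by simp
      then show ?thesis using P sim_mono[OF that(2,1)] by (auto simp: adapted_def)
    qed
    \<comment> \<open>Either \<open>G\<close> misses the parent block, or one point of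
      \<open>G\<close> in it bounds the block average of the norm of \<open>f\<close> by
      \<open>a\<close>.\<close>
    have "E k (\<lambda>x. of_bool (G x)) x \<le> \<eta>"
    proof (cases "\<exists>y. sim k x y \<and> G y")
      case False
      then have "E k (\<lambda>x. of_bool (G x)) x = (0::real)" by (intro E_eq_const) auto
      then show ?thesis using \<eta> by simp
    next
      case True
      then obtain y where y: "sim k x y" "G y" by blast
      then have "E k (\<lambda>x. norm (f x)) y \<le> a"
        using kN by (auto simp: G_def less_emax_iff not_less)
      then have le: "E k (\<lambda>x. norm (f x)) x \<le> a"
        using E_cong_sim[OF y(1)] by metis
      \<comment> \<open>On the parent the transform up to level \<open>k\<close> is at most
        \<open>t\<close>, so to pass \<open>2 * t\<close> the levels above \<open>k\<close> must
        contribute more than \<open>t\<close>.\<close>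
      have "E k (\<lambda>x. of_bool (G x)) x \<le> (E k (\<lambda>x. of_bool (t < tr_max k f x)) x :: real)"
      proof (rule E_mono)
        fix z assume z: "sim k x z"
        have "t < tr_max k f z" if Gz: "G z"
        proof -
          obtain n where n: "n \<le> N" "2 * t < tr 0 n f z"
            using Gz by (auto simp: G_def less_tr_max_iff)
          have kn: "k < n"
            using Pk[of n z] z n t by (force simp: P_def not_less)
          have "tr 0 k f z \<le> t" using Pk[of k z] z by (simp add: P_def)
          moreover have "tr 0 n f z \<le> tr 0 k f z + tr k n f z"
            using kn by (intro tr_triangle) auto
          ultimately have "t < tr k n f z" using n by linarith
          then show ?thesis using kn n kN by (auto simp: less_tr_max_iff)
        qed
        then show "of_bool (G z) \<le> (of_bool (t < tr_max k f z) :: real)" by simp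
      qed
      also have "\<dots> \<le> \<eta>"
        using local_weak_type_tr_max[OF H q \<eta> L a _ le] kN LHa by simp
      finally show ?thesis .
    qed
    \<comment> \<open>Passing from the parent back to the stopped block costs the factor 2 in
      \<open>2 * \<eta>\<close>.\<close>
    moreover have "E (Suc k) (\<lambda>x. of_bool (G x)) x \<le> 2 * (E k (\<lambda>x. of_bool (G x)) x :: real)"
      by (rule E_Suc_le_double) simp
    moreover have "t < tr_max 0 f x" using True by (auto simp: P_def less_tr_max_iff)
    ultimately show ?thesis by (simp add: stopped_def k)
  qed
  have G: "(of_bool (2 * t < tr_max 0 f x) :: real) \<le> of_bool (G x) + of_bool (t < L * H * emax (\<lambda>x. norm (f x)) x)" for x
    using Lp H by (auto simp: G_def a_def field_simps)
  have "mean (\<lambda>x. of_bool (2 * t < tr_max 0 f x)) \<le>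
     mean (\<lambda>x. of_bool (G x) + of_bool (t < L * H * emax (\<lambda>x. norm (f x)) x))"
    by (rule mean_mono) (rule G)
  also have "\<dots> = mean (stopped P (\<lambda>x. of_bool (G x))) + mean (\<lambda>x. of_bool (t < L * H * emax (\<lambda>x. norm (f x)) x))"
    by (simp add: E_add mean_stopped[OF P])
  also have "mean (stopped P (\<lambda>x. of_bool (G x))) \<le> mean (\<lambda>x. 2 * \<eta> * of_bool (t < tr_max 0 f x))"
    by (rule mean_mono) (rule pt)
  finally show ?thesis by (simp add: E_cmult)
qed

text \<open>Integrates the good-lambda inequality and then applies Doob's inequality; each
  contributes one factor \<open>2 powr r\<close> to \<open>4 powr r\<close>.\<close>

lemma strong_type:
  assumes H: "unif_bounded q H" "0 < H" and q: "0 < q" and r: "1 < r"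
    and \<eta>: "\<eta> = 2 powr (- r) / 4" and L: "L = 4 / \<eta> * (2 / \<eta>) powr (1 / q)"
  shows "mean (\<lambda>x. tr 0 N f x powr r) \<le>
    2 * 4 powr r * (L * H) powr r * (r / (r - 1)) * mean (\<lambda>x. norm (f x) powr r)"
proof -
  have "2 powr (- r) \<le> 2 powr (0::real)" using r by (intro powr_mono) auto
  then have \<eta>': "0 < \<eta>" "\<eta> \<le> 1" unfolding \<eta> by auto
  have Lp: "0 < L" using \<eta>' L by simp
  let ?X = "tr_max 0 f" and ?Y = "emax (\<lambda>x. norm (f x))"
  have Y0: "0 \<le> ?Y x" for x
    using E_le_emax[of 0 "\<lambda>x. norm (f x)" x] E_nonneg[of "\<lambda>x. norm (f x)" 0 x] by simp
  have X0: "0 \<le> ?X x" for x by (rule tr_max_nonneg) simp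
  have "(\<Sum>x<2^N. (?X x / 2) powr r) \<le>
      2 * \<eta> * (\<Sum>x<2^N. ?X x powr r) + (\<Sum>x<2^N. (L * H * ?Y x) powr r)"
  proof (rule layer_cake_good_lambda)
    fix t :: real assume t: "0 < t"
    have "t < u / 2 \<longleftrightarrow> 2 * t < u" for u by auto
    then show "(\<Sum>x<2^N. of_bool (t < ?X x / 2)) \<le>
      2 * \<eta> * (\<Sum>x<2^N. of_bool (t < ?X x)) + (\<Sum>x<2^N. of_bool (t < L * H * ?Y x))"
      using good_lambda[OF H q \<eta>' L t, of f]
      by (simp add: mean_eq divide_simps)
  qed (use Y0 X0 Lp H r in auto)
  \<comment> \<open>Here \<open>2 * \<eta>\<close> is half of \<open>2 powr (- r)\<close>, so the
    term with \<open>?X\<close> on the right is absorbed; the sums are finite, so it may be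
    subtracted.\<close>
  then have "2 powr (- r) * (\<Sum>x<2^N. ?X x powr r) \<le>
      2 powr (- r) / 2 * (\<Sum>x<2^N. ?X x powr r) + (L * H) powr r * (\<Sum>x<2^N. ?Y x powr r)"
    using X0 Y0 Lp H by (simp add: powr_mult powr_divide \<eta> powr_minus_divide sum_distrib_left sum_divide_distrib mult_ac)
  then have "(\<Sum>x<2^N. ?X x powr r) \<le> 2 * 2 powr r * (L * H) powr r * (\<Sum>x<2^N. ?Y x powr r)"
    by (simp add: powr_minus_divide field_simps)
  then have "mean (\<lambda>x. ?X x powr r) \<le> 2 * 2 powr r * (L * H) powr r * mean (\<lambda>x. ?Y x powr r)"
    unfolding mean_eq using divide_right_mono[of _ _ "2^N"] by fastforce
  also have "\<dots> \<le> 2 * 2 powr r * (L * H) powr r * (2 powr r * (r / (r - 1)) * mean (\<lambda>x. norm (f x) powr r))"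
    by (intro mult_left_mono emax_strong_type) (use r in auto)
  also have "\<dots> = 2 * 4 powr r * (L * H) powr r * (r / (r - 1)) * mean (\<lambda>x. norm (f x) powr r)"
    using powr_mult[of 2 2 r] by simp
  finally have "mean (\<lambda>x. ?X x powr r) \<le> \<dots>" .
  moreover have "mean (\<lambda>x. tr 0 N f x powr r) \<le> mean (\<lambda>x. ?X x powr r)"
    using r by (intro mean_mono powr_mono2 tr_le_tr_max tr_nonneg) auto
  ultimately show ?thesis by linarith
qed

end

text \<open>The order of quantifiers is the point: \<open>K\<close> depends on \<open>q\<close> and
  \<open>r\<close> only, not on the size or entries of the matrix.\<close>

theorem extrapolation:
  fixes q r :: real
  assumes q: "0 < q" and r: "1 < r"
  shows "\<exists>K>0. \<forall>M N A H f. 0 < H \<longrightarrow> matrix_transform.unif_bounded N M A q H \<longrightarrow>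
    dyadic.mean N (\<lambda>x. matrix_transform.tr N M A 0 N f x powr r) \<le>
    (K * H) powr r * dyadic.mean N (\<lambda>x. norm (f x) powr r)"
proof -
  define \<eta> :: real where \<eta>: "\<eta> = 2 powr (- r) / 4"
  define L where L: "L = 4 / \<eta> * (2 / \<eta>) powr (1 / q)"
  define B where "B = 2 * 4 powr r * (r / (r - 1))"
  define K where "K = L * B powr (1 / r)"
  have Lp: "0 < L" by (simp add: L \<eta>)
  have B: "0 < B" using r by (simp add: B_def)
  have K: "0 < K" using Lp B by (simp add: K_def)
  have eq: "(K * H) powr r = 2 * 4 powr r * (L * H) powr r * (r / (r - 1))" if "0 < H" for H
    using that B r Lp by (simp add: K_def powr_mult powr_powr) (simp add: B_def)
  show ?thesis
    using matrix_transform.strong_type[OF _ _ q r \<eta> L] eq K by (intro exI[of _ K]) auto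
qed

section \<open>Transfer to the unit interval\<close>

text \<open>By convexity the graph of the \<open>r\<close>-th power lies above its tangent at
  \<open>c\<close>; this is Young's inequality with weights \<open>1 / r\<close> and
  \<open>1 - 1 / r\<close>.\<close>

lemma powr_tangent_le:
  fixes r c t :: real
  assumes r: "1 \<le> r" and c: "0 < c" and t: "0 \<le> t"
  shows "r * c powr (r - 1) * t \<le> t powr r + (r - 1) * c powr r"
proof (cases "t = 0")
  case False
  have "(t powr r) powr (1 / r) * (c powr r) powr (1 - 1 / r) \<le> 1 / r * t powr r + (1 - 1 / r) * c powr r"
    using assms False by (intro Youngs_inequality_0) auto
  moreover have "(t powr r) powr (1 / r) = t" using r t by (simp add: powr_powr)
  moreover have "(c powr r) powr (1 - 1 / r) = c powr (r - 1)"
    using r by (simp add: powr_powr right_diff_distrib)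
  ultimately have "t * c powr (r - 1) \<le> 1 / r * t powr r + (1 - 1 / r) * c powr r" by simp
  then have "r * (t * c powr (r - 1)) \<le> r * (1 / r * t powr r + (1 - 1 / r) * c powr r)"
    using r by (intro mult_left_mono) auto
  also have "\<dots> = (r * (1 / r)) * t powr r + (r * (1 - 1 / r)) * c powr r"
    by (simp only: distrib_left mult.assoc)
  also have "r * (1 - 1 / r) = r - 1" using r by (simp add: right_diff_distrib)
  finally show ?thesis using r by (simp add: mult_ac)
qed (use r c in auto)

text \<open>L_r lies in L_1 on a set of finite measure: the tangent at \<open>c = 1\<close> gives an
  integrable majorant.\<close>

lemma set_integrable_powr_imp:
  fixes g :: "'a \<Rightarrow> 'b::{banach, second_countable_topology}"
  assumes S: "S \<in> sets M" "emeasure M S < \<infinity>" and r: "1 \<le> r"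
    and g: "g \<in> borel_measurable M" and int: "set_integrable M S (\<lambda>x. norm (g x) powr r)"
  shows "set_integrable M S g"
proof (rule set_integrable_bound)
  show "set_integrable M S (\<lambda>x. norm (g x) powr r + r)"
    using int S by (intro set_integral_add) (auto simp: set_integrable_def)
  show "set_borel_measurable M S g"
    using g S by (simp add: set_borel_measurable_def)
  have "norm (g x) \<le> norm (norm (g x) powr r + r)" for x
  proof -
    have "1 * norm (g x) \<le> r * norm (g x)" using r by (intro mult_right_mono) auto
    also have "\<dots> \<le> norm (g x) powr r + (r - 1)"
      using powr_tangent_le[of r 1 "norm (g x)"] r by simp
    finally show ?thesis using r by simp
  qed
  then show "AE x in M. x \<in> S \<longrightarrow> norm (g x) \<le> norm (norm (g x) powr r + r)" by simp
qed

text \<open>Integrate the tangent inequality at the average \<open>c\<close>. A zero average is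
  treated apart because the tangent lemma asks for \<open>0 < c\<close>.\<close>

lemma jensen_powr:
  fixes g :: "'a \<Rightarrow> real"
  assumes S: "S \<in> sets M" "emeasure M S < \<infinity>" "0 < measure M S" and r: "1 \<le> r"
    and g: "g \<in> borel_measurable M" "\<And>x. 0 \<le> g x" and int: "set_integrable M S (\<lambda>x. g x powr r)"
  shows "((LINT x:S|M. g x) / measure M S) powr r \<le> (LINT x:S|M. g x powr r) / measure M S"
proof -
  define c where "c = (LINT x:S|M. g x) / measure M S"
  have gi: "set_integrable M S g"
    using set_integrable_powr_imp[OF S(1,2) r g(1)] int g(2) by simp
  have nn: "0 \<le> (LINT x:S|M. h x)" if "\<And>x. 0 \<le> h x" for h :: "'a \<Rightarrow> real"
    unfolding set_lebesgue_integral_def using that by (intro integral_nonneg_AE) auto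
  have c0: "0 \<le> c" using nn[of g] g S by (simp add: c_def)
  show ?thesis
  proof (cases "c = 0")
    case True
    then show ?thesis unfolding c_def[symmetric] using nn[of "\<lambda>x. g x powr r"] S by simp
  next
    case False
    then have c: "0 < c" using c0 by simp
    have ci: "set_integrable M S (\<lambda>_. (r - 1) * c powr r)"
      using S by (simp add: set_integrable_def)
    have "(LINT x:S|M. r * c powr (r - 1) * g x) \<le> (LINT x:S|M. g x powr r + (r - 1) * c powr r)"
      using r c g by (intro set_integral_mono set_integrable_mult_right gi set_integral_add(1) int ci powr_tangent_le) auto
    also have "\<dots> = (LINT x:S|M. g x powr r) + (r - 1) * c powr r * measure M S"
      using S by (subst set_integral_add(2)[OF int ci]) (simp add: set_integral_const)
    finally have 1: "r * c powr (r - 1) * (LINT x:S|M. g x) \<le> (LINT x:S|M. g x powr r) + (r - 1) * c powr r * measure M S"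
      by simp
    have "(LINT x:S|M. g x) = c * measure M S" using S by (simp add: c_def)
    moreover have "c powr (r - 1) * c = c powr r"
      using c powr_add[of c "r - 1" 1] by simp
    ultimately have "r * c powr (r - 1) * (LINT x:S|M. g x) = r * c powr r * measure M S"
      by (metis mult.assoc mult.commute)
    with 1 have "r * c powr r * measure M S \<le> (LINT x:S|M. g x powr r) + (r - 1) * c powr r * measure M S"
      by (simp only:)
    then have "c powr r * measure M S \<le> (LINT x:S|M. g x powr r)"
      by (simp add: algebra_simps)
    then show ?thesis unfolding c_def[symmetric] using S by (simp add: field_simps)
  qed
qed

section \<open>Dyadic cells and step functions on the unit interval\<close>

lemma set_integral_consecutive:
  fixes f :: "real \<Rightarrow> 'a::{banach, second_countable_topology}"
  assumes h: "0 \<le> h" and int: "set_integrable lborel {u..<u + real m * h} f"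
  shows "(LINT x:{u..<u + real m * h}|lborel. f x) =
    (\<Sum>i<m. LINT x:{u + real i * h..<u + (real i + 1) * h}|lborel. f x)"
  using int
proof (induction m)
  case (Suc m)
  have eq: "{u..<u + real (Suc m) * h} = {u..<u + real m * h} \<union> {u + real m * h..<u + (real m + 1) * h}"
    using h by (auto simp: algebra_simps) (smt (verit) h mult_nonneg_nonneg of_nat_0_le_iff)
  have i1: "set_integrable lborel {u..<u + real m * h} f"
    "set_integrable lborel {u + real m * h..<u + (real m + 1) * h} f"
    using Suc.prems eq by (auto intro: set_integrable_subset)
  show ?case unfolding eq using Suc.IH[OF i1(1)] i1
    by (subst set_integral_Un) auto
qed (simp add: set_lebesgue_integral_def)

definition cell :: "nat \<Rightarrow> nat \<Rightarrow> real set" where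
  "cell N i = {real i / 2^N ..< (real i + 1) / 2^N}"

definition idx :: "nat \<Rightarrow> real \<Rightarrow> nat" where
  "idx N x = nat \<lfloor>x * 2^N\<rfloor>"

text \<open>The conditional expectation at level \<open>N\<close>, read as a function of the cell
  index; this carries \<open>f\<close> to the finite model.\<close>

definition cell_avg :: "nat \<Rightarrow> (real \<Rightarrow> complex) \<Rightarrow> nat \<Rightarrow> complex" where
  "cell_avg N f i = of_real (2^N) * (LINT y:cell N i|lborel. f y)"

lemma idx_cell: "x \<in> cell N i \<Longrightarrow> idx N x = i"
proof -
  assume "x \<in> cell N i"
  then have "\<lfloor>x * 2^N\<rfloor> = int i"
    by (intro floor_unique) (auto simp: cell_def field_simps)
  then show ?thesis by (simp add: idx_def)
qed

lemma idx_less: "x \<in> {0..<1} \<Longrightarrow> idx N x < 2^N"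
proof -
  assume x: "x \<in> {0..<1}"
  then have "\<lfloor>x * 2^N\<rfloor> < 2^N" by (simp add: floor_less_iff)
  then show ?thesis using x by (simp add: idx_def nat_less_iff)
qed

lemma cell_subset: "i < 2^N \<Longrightarrow> cell N i \<subseteq> {0..<1}"
proof -
  assume "i < 2^N"
  then have "real (i + 1) \<le> real (2^N)" by (intro of_nat_mono) simp
  then have "(real i + 1) / 2^N \<le> 1" by simp
  moreover have "0 \<le> real i / 2^N" by simp
  ultimately show ?thesis unfolding cell_def by (auto simp del: zero_le_divide_iff)
qed

lemma cell_sets [measurable, simp]: "cell N i \<in> sets borel"
  by (simp add: cell_def)

lemma measure_cell: "measure lborel (cell N i) = 1 / 2^N"
  by (simp add: cell_def divide_right_mono flip: diff_divide_distrib)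

lemma emeasure_cell: "emeasure lborel (cell N i) < \<infinity>"
  by (simp add: cell_def divide_right_mono)

text \<open>Integer division of the level-\<open>N\<close> floor gives the level-\<open>k\<close>
  floor. The upper end has the form that \<open>set_integral_consecutive\<close> expects.\<close>

lemma dyad_atom_eq:
  assumes x: "x \<in> {0..<1}" and k: "k \<le> N"
  shows "dyad_atom k x = {real (2^(N-k) * (idx N x div 2^(N-k))) / 2^N ..<
     real (2^(N-k) * (idx N x div 2^(N-k))) / 2^N + real (2^(N-k)) * (1 / 2^N)}"
proof -
  have pw: "(2::real)^N = 2^k * 2^(N-k)" using k by (simp flip: power_add)
  have "x * 2^k = x * 2^N / real_of_int (2^(N-k))" using pw by simp
  then have "\<lfloor>x * 2^k\<rfloor> = \<lfloor>x * 2^N\<rfloor> div 2^(N-k)"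
    by (simp only: floor_divide_real_eq_div zero_le_power zero_le_numeral)
  also have "\<lfloor>x * 2^N\<rfloor> = int (idx N x)" using x by (simp add: idx_def)
  finally have "\<lfloor>x * 2^k\<rfloor> = int (idx N x div 2^(N-k))" by (simp add: zdiv_int)
  then show ?thesis unfolding dyad_atom_def by (simp add: pw add_divide_distrib)
qed

text \<open>An atom of level \<open>k\<close> consists of \<open>2^(N-k)\<close> consecutive cells,
  so up to level \<open>N\<close> only the cell averages of \<open>f\<close> matter.\<close>

lemma cond_exp_dyad_eq:
  assumes int: "set_integrable lborel {0..<1} f" and x: "x \<in> {0..<1}" and k: "k \<le> N"
  shows "cond_exp_dyad k f x = dyadic.E N k (cell_avg N f) (idx N x)"
proof -
  define c where "c = 2^(N-k) * (idx N x div 2^(N-k))"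
  define u where "u = real c / 2^N"
  have at: "dyad_atom k x = {u..<u + real (2^(N-k)) * (1 / 2^N)}"
    unfolding u_def c_def using dyad_atom_eq[OF x k] .
  have pN: "(2::nat)^N = 2^k * 2^(N-k)" using k by (simp flip: power_add)
  have "idx N x div 2^(N-k) < 2^k"
    using idx_less[OF x, of N] unfolding pN by (simp add: less_mult_imp_div_less)
  then have "2^(N-k) * Suc (idx N x div 2^(N-k)) \<le> 2^(N-k) * 2^k" by (intro mult_left_mono) auto
  then have "c + 2^(N-k) \<le> 2^N" unfolding pN c_def by (simp add: algebra_simps)
  then have "real (c + 2^(N-k)) \<le> real (2^N)" by (intro of_nat_mono)
  then have "u + real (2^(N-k)) * (1 / 2^N) \<le> 1" by (simp add: u_def field_simps)
  moreover have "0 \<le> u" by (simp add: u_def)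
  ultimately have "dyad_atom k x \<subseteq> {0..<1}" unfolding at by fastforce
  then have "set_integrable lborel (dyad_atom k x) f"
    by (rule set_integrable_subset[OF int, rotated]) (simp add: at)
  then have "(LINT y:dyad_atom k x|lborel. f y) =
     (\<Sum>i<2^(N-k). LINT y:{u + real i * (1 / 2^N)..<u + (real i + 1) * (1 / 2^N)}|lborel. f y)"
    unfolding at by (intro set_integral_consecutive) auto
  also have "\<dots> = (\<Sum>i<2^(N-k). LINT y:cell N (c + i)|lborel. f y)"
    by (intro sum.cong refl arg_cong[where f="\<lambda>S. set_lebesgue_integral lborel S f"])
      (simp add: cell_def u_def add_divide_distrib add_ac)
  finally have eq: "(LINT y:dyad_atom k x|lborel. f y) = (\<Sum>i<2^(N-k). LINT y:cell N (c + i)|lborel. f y)" .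
  have pc: "(2::complex)^N = 2^k * 2^(N-k)" using k by (simp flip: power_add)
  show ?thesis
    unfolding cond_exp_dyad_def eq dyadic.E_def bavg_def c_def[symmetric] cell_avg_def
    by (simp add: scaleR_conv_of_real pc flip: sum_distrib_left)
qed

lemma idx_step_integral:
  fixes g :: "nat \<Rightarrow> 'a::{banach, second_countable_topology}"
  shows "set_integrable lborel (cell N i) (\<lambda>x. g (idx N x))"
    "(LINT x:cell N i|lborel. g (idx N x)) = (1 / 2^N) *\<^sub>R g i"
proof -
  have "set_integrable lborel (cell N i) (\<lambda>x. g (idx N x)) = set_integrable lborel (cell N i) (\<lambda>x. g i)"
    by (intro set_integrable_cong) (auto simp: idx_cell)
  then show "set_integrable lborel (cell N i) (\<lambda>x. g (idx N x))"
    using emeasure_cell[of N i] unfolding set_integrable_def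
    by (simp only:) (intro integrable_scaleR_left, simp)
  have "(LINT x:cell N i|lborel. g (idx N x)) = (LINT x:cell N i|lborel. g i)"
    by (intro set_lebesgue_integral_cong) (auto simp: idx_cell)
  also have "\<dots> = (1 / 2^N) *\<^sub>R g i"
    using emeasure_cell[of N i] by (simp add: set_integral_const measure_cell)
  finally show "(LINT x:cell N i|lborel. g (idx N x)) = (1 / 2^N) *\<^sub>R g i" .
qed

lemma UN_cell: "{0..<1} = (\<Union>i<2^N. cell N i)"
proof
  show "{0..<1} \<subseteq> (\<Union>i<2^N. cell N i)"
  proof
    fix x :: real assume x: "x \<in> {0..<1}"
    have "x \<in> cell N (idx N x)"
    proof -
      have "real (idx N x) = of_int \<lfloor>x * 2^N\<rfloor>" using x by (simp add: idx_def)
      then show ?thesis unfolding cell_def using floor_correct[of "x * 2^N"] by (auto simp: field_simps)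
    qed
    then show "x \<in> (\<Union>i<2^N. cell N i)" using idx_less[OF x] by auto
  qed
qed (use cell_subset in auto)

lemma set_integral_cells:
  fixes f :: "real \<Rightarrow> 'a::{banach, second_countable_topology}"
  assumes "set_integrable lborel {0..<1} f"
  shows "(LINT x:{0..<1}|lborel. f x) = (\<Sum>i<2^N. LINT x:cell N i|lborel. f x)"
  using set_integral_consecutive[of "1 / 2^N" 0 "2^N" f] assms by (simp add: cell_def)

lemma idx_integrable:
  fixes g :: "nat \<Rightarrow> 'a::{banach, second_countable_topology}"
  shows "set_integrable lborel {0..<1} (\<lambda>x. g (idx N x))"
  unfolding UN_cell[of N] by (intro set_integrable_UN idx_step_integral) auto

lemma idx_integral:
  "(LINT x:{0..<1}|lborel. g (idx N x)) = dyadic.mean N g"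
  by (subst set_integral_cells[OF idx_integrable, of _ _ N])
    (simp add: idx_step_integral dyadic.mean_eq sum_divide_distrib)

lemma idx_measurable [measurable]: "(\<lambda>x. g (idx N x)) \<in> borel_measurable lborel"
  unfolding idx_def by measurable

lemma cell_avg_step: "cell_avg N (\<lambda>x. F (idx N x)) = F"
  by (rule ext) (simp add: cell_avg_def idx_step_integral scaleR_conv_of_real)

lemma max_transform_eq:
  assumes "set_integrable lborel {0..<1} f" "x \<in> {0..<1}"
  shows "max_transform M N A f x = of_real (matrix_transform.tr N M A 0 N (cell_avg N f) (idx N x))"
proof -
  have "mart_diff k f x = matrix_transform.D N k (cell_avg N f) (idx N x)" if "k \<le> N" for k
    using that by (simp add: mart_diff_def matrix_transform.D_def cond_exp_dyad_eq[OF assms])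
  moreover have "{1..N} = {0<..N}" by auto
  ultimately show ?thesis
    unfolding max_transform_def matrix_transform.tr_def matrix_transform.supn_def by simp
qed

lemma Lp_norm_max_transform:
  assumes "set_integrable lborel {0..<1} f"
  shows "Lp_norm q (max_transform M N A f) =
    dyadic.mean N (\<lambda>i. matrix_transform.tr N M A 0 N (cell_avg N f) i powr q) powr (1 / q)"
proof -
  have "(LINT x:{0..<1}|lborel. norm (max_transform M N A f x) powr q) =
      (LINT x:{0..<1}|lborel. matrix_transform.tr N M A 0 N (cell_avg N f) (idx N x) powr q)"
    by (intro set_lebesgue_integral_cong)
      (auto simp: max_transform_eq[OF assms] matrix_transform.tr_nonneg)
  then show ?thesis 
    unfolding Lp_norm_def
    by (simp only: idx_integral[of "\<lambda>i. matrix_transform.tr N M A 0 N (cell_avg N f) i powr q"])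
qed

text \<open>Jensen's inequality with exponent \<open>r / q\<close> for the step function of
  \<open>g\<close> on a space of total mass 1.\<close>

lemma mean_powr_mono:
  assumes "0 < q" "q \<le> r" "\<And>i. 0 \<le> g i"
  shows "dyadic.mean N (\<lambda>i. g i powr q) powr (1 / q) \<le> dyadic.mean N (\<lambda>i. g i powr r) powr (1 / r)"
proof -
  have "((LINT x:{0..<1}|lborel. g (idx N x) powr q) / measure lborel {0..<1::real}) powr (r / q) \<le>
     (LINT x:{0..<1}|lborel. (g (idx N x) powr q) powr (r / q)) / measure lborel {0..<1::real}"
    using assms by (intro jensen_powr idx_integrable) auto
  then have le: "dyadic.mean N (\<lambda>i. g i powr q) powr (r / q) \<le> dyadic.mean N (\<lambda>i. g i powr r)"
    using assms by (simp add: powr_powr idx_integral[of "\<lambda>i. g i powr q"] idx_integral[of "\<lambda>i. g i powr r"])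
  have "dyadic.mean N (\<lambda>i. g i powr q) powr (1 / q) = (dyadic.mean N (\<lambda>i. g i powr q) powr (r / q)) powr (1 / r)"
    using assms by (simp add: powr_powr)
  also have "\<dots> \<le> dyadic.mean N (\<lambda>i. g i powr r) powr (1 / r)"
    using assms le by (intro powr_mono2) auto
  finally show ?thesis .
qed

text \<open>Discretisation does not increase the L_r norm, by Jensen's inequality on each
  cell.\<close>

lemma mean_cell_avg_le:
  assumes f: "in_Lp r f" and r: "1 \<le> r"
  shows "dyadic.mean N (\<lambda>i. norm (cell_avg N f i) powr r) \<le> (LINT x:{0..<1}|lborel. norm (f x) powr r)"
proof -
  have fm: "f \<in> borel_measurable lborel" and
    fi: "set_integrable lborel {0..<1} (\<lambda>x. norm (f x) powr r)" using f by (auto simp: in_Lp_def)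
  have "norm (cell_avg N f i) powr r / 2^N \<le> (LINT x:cell N i|lborel. norm (f x) powr r)" if "i < 2^N" for i
  proof -
    have ci: "set_integrable lborel (cell N i) (\<lambda>x. norm (f x) powr r)"
      using cell_subset[OF that] by (intro set_integrable_subset[OF fi]) auto
    have "norm (cell_avg N f i) = 2^N * norm (LINT y:cell N i|lborel. f y)"
      by (simp add: cell_avg_def norm_mult norm_power)
    also have "\<dots> \<le> 2^N * (LINT y:cell N i|lborel. norm (f y))"
      by (intro mult_left_mono set_integral_norm_bound set_integrable_powr_imp[OF _ _ r fm ci] emeasure_cell) auto
    also have "\<dots> = (LINT y:cell N i|lborel. norm (f y)) / measure lborel (cell N i)"
      by (simp add: measure_cell)
    finally have "norm (cell_avg N f i) powr r \<le> \<dots> powr r"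
      using r by (intro powr_mono2) auto
    also have "\<dots> \<le> (LINT x:cell N i|lborel. norm (f x) powr r) / measure lborel (cell N i)"
      using r fm ci emeasure_cell by (intro jensen_powr) (auto simp: measure_cell)
    finally show ?thesis by (simp add: measure_cell field_simps)
  qed
  then have "(\<Sum>i<2^N. norm (cell_avg N f i) powr r / 2^N) \<le> (\<Sum>i<2^N. LINT x:cell N i|lborel. norm (f x) powr r)"
    by (intro sum_mono) auto
  then show ?thesis
    by (simp add: dyadic.mean_eq set_integral_cells[OF fi, of N] sum_divide_distrib)
qed

text \<open>A crude bound that depends on the matrix, used only to show that the constants are
  finite. Each difference is at most 2 in norm, and the summand 1 in \<open>B\<close> keeps it
  positive.\<close>

lemma (in matrix_transform) ex_unif_bounded:
  assumes "0 < q"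
  shows "\<exists>H>0. unif_bounded q H"
proof (intro exI conjI)
  define B where "B = 1 + (\<Sum>j\<in>{1..M}. \<Sum>k\<in>{0<..N}. norm (A j k) * 2)"
  have nn: "0 \<le> (\<Sum>k\<in>{0<..N}. norm (A j k) * 2)" for j by (intro sum_nonneg) auto
  then show B: "0 < B" unfolding B_def by (intro add_pos_nonneg sum_nonneg) auto
  show "unif_bounded q B"
    unfolding unif_bounded_def
  proof (intro allI impI)
    fix f :: "nat \<Rightarrow> complex" assume f: "\<forall>x<2^N. norm (f x) \<le> 1"
    have "tr 0 N f x \<le> B" if x: "x < 2^N" for x
    proof -
      have E1: "norm (E k f x) \<le> 1" for k
      proof -
        have "E k (\<lambda>y. norm (f y)) x \<le> E k (\<lambda>_. 1) x"
        proof (rule E_mono)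
          fix y assume "sim k x y"
          then have "sim 0 x y" by (rule sim_mono) simp
          then have "y div 2^N = 0" using x by (simp add: sim_def)
          then have "y < 2^N" by (simp add: div_eq_0_iff)
          then show "norm (f y) \<le> 1" using f by simp
        qed
        then show ?thesis using norm_E_le[of k f x] by (simp add: E_const)
      qed
      have D2: "norm (D k f x) \<le> 2" for k
        unfolding D_def using norm_triangle_ineq4[of "E k f x" "E (k-1) f x"] E1[of k] E1[of "k-1"] by linarith
      have "norm (\<Sum>k\<in>{0<..N}. A j k * D k f x) \<le> B" if j: "j \<in> {1..M}" for j
      proof -
        have "norm (\<Sum>k\<in>{0<..N}. A j k * D k f x) \<le> (\<Sum>k\<in>{0<..N}. norm (A j k) * 2)"
          by (intro sum_norm_le) (auto simp: norm_mult intro!: mult_left_mono D2)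
        also have "\<dots> \<le> (\<Sum>j\<in>{1..M}. \<Sum>k\<in>{0<..N}. norm (A j k) * 2)"
          using j nn by (intro member_le_sum) auto
        finally show ?thesis by (simp add: B_def)
      qed
      then show ?thesis unfolding tr_def using B by (simp add: supn_le_iff)
    qed
    then have "mean (\<lambda>x. tr 0 N f x powr q) \<le> mean (\<lambda>_. B powr q)"
      using assms by (intro mean_mono powr_mono2 tr_nonneg) auto
    then show "mean (\<lambda>x. tr 0 N f x powr q) \<le> B powr q" by (simp add: E_const)
  qed
qed

section \<open>Comparison of the best constants\<close>

definition bounds :: "real \<Rightarrow> real \<Rightarrow> nat \<Rightarrow> nat \<Rightarrow> (nat \<Rightarrow> nat \<Rightarrow> complex) \<Rightarrow> real set" where
  "bounds p q M N A = {C. 0 \<le> C \<and>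
     (\<forall>f. in_Lp p f \<longrightarrow> Lp_norm q (max_transform M N A f) \<le> C * Lp_norm p f)}"

text \<open>Test the bound on step functions over the cells: values of norm at most 1 give L_p norm
  at most 1. The slack \<open>C \<le> H\<close> lets \<open>H\<close> be positive when
  \<open>C\<close> is \<open>0\<close>.\<close>

lemma bounds_imp_unif_bounded:
  assumes C: "C \<in> bounds p q M N A" and pq: "0 < p" "0 < q" and H: "C \<le> H"
  shows "matrix_transform.unif_bounded N M A q H"
  unfolding matrix_transform.unif_bounded_def
proof (intro allI impI)
  fix F :: "nat \<Rightarrow> complex" assume F: "\<forall>x<2^N. norm (F x) \<le> 1"
  define f where "f = (\<lambda>x. F (idx N x))"
  let ?m = "dyadic.mean N (\<lambda>i. matrix_transform.tr N M A 0 N F i powr q)"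
  have f: "in_Lp p f"
    unfolding in_Lp_def f_def by (intro conjI idx_measurable idx_integrable)
  have fi: "set_integrable lborel {0..<1} f" unfolding f_def by (rule idx_integrable)
  have "dyadic.mean N (\<lambda>i. norm (F i) powr p) \<le> dyadic.mean N (\<lambda>_. 1)"
    using F pq by (intro dyadic.mean_mono) (auto simp: powr_le1)
  then have "dyadic.mean N (\<lambda>i. norm (F i) powr p) \<le> 1" by (simp add: dyadic.E_const)
  moreover have "0 \<le> dyadic.mean N (\<lambda>i. norm (F i) powr p)" by (rule dyadic.E_nonneg) simp
  ultimately have "dyadic.mean N (\<lambda>i. norm (F i) powr p) powr (1 / p) \<le> 1 powr (1 / p)"
    using pq by (intro powr_mono2) auto
  moreover have "Lp_norm p f = dyadic.mean N (\<lambda>i. norm (F i) powr p) powr (1 / p)"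
    using idx_integral[of "\<lambda>i. norm (F i) powr p" N] by (simp add: Lp_norm_def f_def)
  ultimately have n1: "Lp_norm p f \<le> 1" by simp
  have "?m powr (1 / q) = Lp_norm q (max_transform M N A f)"
    using Lp_norm_max_transform[OF fi, of q M N A] cell_avg_step[of N F] by (simp add: f_def)
  also have "\<dots> \<le> C * Lp_norm p f" using C f by (simp add: bounds_def)
  also have "\<dots> \<le> C * 1" using C n1 by (intro mult_left_mono) (auto simp: bounds_def)
  finally have le: "?m powr (1 / q) \<le> H" using H by simp
  have m0: "0 \<le> ?m" by (intro dyadic.E_nonneg) simp
  have "?m = (?m powr (1 / q)) powr q" using m0 pq by (simp add: powr_powr)
  also have "\<dots> \<le> H powr q" using le pq by (intro powr_mono2) auto
  finally show "?m \<le> H powr q" .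
qed

text \<open>Passing to cell averages keeps the transform and does not increase the norm of
  \<open>f\<close>; lowering the exponent on the left from \<open>r\<close> to \<open>q\<close>
  costs nothing.\<close>

lemma bounds_if_discrete:
  assumes le: "\<And>F. dyadic.mean N (\<lambda>x. matrix_transform.tr N M A 0 N F x powr r) \<le>
      B powr r * dyadic.mean N (\<lambda>x. norm (F x) powr r)"
    and r: "1 \<le> r" and q: "0 < q" "q \<le> r" and B: "0 \<le> B"
  shows "B \<in> bounds r q M N A"
  unfolding bounds_def
proof (intro CollectI conjI allI impI B)
  fix f assume f: "in_Lp r f"
  have fi: "set_integrable lborel {0..<1} f"
    using f r by (rule_tac set_integrable_powr_imp[where r=r]) (auto simp: in_Lp_def)
  let ?F = "cell_avg N f"
  let ?I = "LINT x:{0..<1}|lborel. norm (f x) powr r"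
  have "Lp_norm q (max_transform M N A f) \<le>
      dyadic.mean N (\<lambda>x. matrix_transform.tr N M A 0 N ?F x powr r) powr (1 / r)"
    unfolding Lp_norm_max_transform[OF fi] using q matrix_transform.tr_nonneg by (intro mean_powr_mono)
  also have "\<dots> \<le> (B powr r * ?I) powr (1 / r)"
  proof (intro powr_mono2)
    have "dyadic.mean N (\<lambda>x. matrix_transform.tr N M A 0 N ?F x powr r) \<le>
      B powr r * dyadic.mean N (\<lambda>x. norm (?F x) powr r)" by (rule le)
    also have "\<dots> \<le> B powr r * ?I"
      by (intro mult_left_mono mean_cell_avg_le f r) simp
    finally show "dyadic.mean N (\<lambda>x. matrix_transform.tr N M A 0 N ?F x powr r) \<le> B powr r * ?I" .
  qed (use r in \<open>auto intro: dyadic.E_nonneg\<close>)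
  also have "\<dots> = B * Lp_norm r f"
    using r B by (simp add: powr_mult powr_powr Lp_norm_def)
  finally show "Lp_norm q (max_transform M N A f) \<le> B * Lp_norm r f" .
qed

text \<open>Keeps the infimum in \<open>h_pq\<close> from ranging over the empty set: extrapolating
  the crude bound to exponent \<open>p\<close> yields an element.\<close>

lemma bounds_nonempty:
  assumes pq: "1 < p" "0 < q" "q \<le> p"
  shows "bounds p q M N A \<noteq> {}"
proof -
  obtain H where H: "0 < H" "matrix_transform.unif_bounded N M A q H"
    using matrix_transform.ex_unif_bounded[OF pq(2)] by blast
  obtain K where K: "0 < K" "\<forall>M N A H f. 0 < H \<longrightarrow> matrix_transform.unif_bounded N M A q H \<longrightarrow>
    dyadic.mean N (\<lambda>x. matrix_transform.tr N M A 0 N f x powr p) \<le>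
    (K * H) powr p * dyadic.mean N (\<lambda>x. norm (f x) powr p)"
    using extrapolation[OF pq(2,1)] by (elim exE conjE)
  have "K * H \<in> bounds p q M N A"
    using H K(1) pq by (intro bounds_if_discrete K(2)[rule_format]) auto
  then show ?thesis by blast
qed

lemma h_pq_le_h_pq:
  fixes p q p' q' :: real
  assumes pq: "1 < p" "0 < q" "q \<le> p" and pq': "1 < p'" "0 < q'" "q' \<le> p'"
  shows "\<exists>K>0. \<forall>M N A. h_pq p' q' M N A \<le> K * h_pq p q M N A"
proof -
  obtain K where K: "0 < K" and ext: "\<forall>M N A H f. 0 < H \<longrightarrow> matrix_transform.unif_bounded N M A q H \<longrightarrow>
    dyadic.mean N (\<lambda>x. matrix_transform.tr N M A 0 N f x powr p') \<le>
    (K * H) powr p' * dyadic.mean N (\<lambda>x. norm (f x) powr p')"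
    using extrapolation[OF pq(2) pq'(1)] by (elim exE conjE)
  have "h_pq p' q' M N A \<le> K * h_pq p q M N A" for M N A
  proof -
    have "h_pq p' q' M N A / K \<le> C" if C: "C \<in> bounds p q M N A" for C
    \<comment> \<open>\<open>extrapolation\<close> asks for a positive constant, but
      \<open>C\<close> may be \<open>0\<close>.\<close>
    proof (rule field_le_epsilon)
      fix e :: real assume e: "0 < e"
      have C0: "0 \<le> C" using C by (simp add: bounds_def)
      have "matrix_transform.unif_bounded N M A q (C + e)"
        using C pq e by (intro bounds_imp_unif_bounded[OF C]) auto
      then have "K * (C + e) \<in> bounds p' q' M N A"
        using C0 e K pq' by (intro bounds_if_discrete ext[rule_format]) auto
      then have "h_pq p' q' M N A \<le> K * (C + e)"
        unfolding h_pq_def bounds_def by (intro cInf_lower) (auto intro: bdd_belowI[of _ 0])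
      then show "h_pq p' q' M N A / K \<le> C + e" using K by (simp add: field_simps)
    qed
    then have "h_pq p' q' M N A / K \<le> Inf (bounds p q M N A)"
      using bounds_nonempty[OF pq] by (intro cInf_greatest) auto
    then show ?thesis using K by (simp add: h_pq_def bounds_def field_simps)
  qed
  then show ?thesis using K by blast
qed

lemma h_pq_nonneg:
  assumes "1 < p" "0 < q" "q \<le> p"
  shows "0 \<le> h_pq p q M N A"
proof -
  have "0 \<le> Inf (bounds p q M N A)"
    using bounds_nonempty[OF assms] by (rule cInf_greatest) (simp add: bounds_def)
  then show ?thesis by (simp add: h_pq_def bounds_def)
qed

theorem theorem2p2:
  fixes p q :: real
  assumes "1 < p" and "0 < q" and "q < p"
  shows "\<exists>C>0. \<forall>(M::nat) (N::nat) (A::nat \<Rightarrow> nat \<Rightarrow> complex).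
           h_const M N A / C \<le> h_pq p q M N A \<and> h_pq p q M N A \<le> C * h_const M N A"
proof -
  obtain K1 where K1: "0 < K1" "\<And>M N A. h_pq 2 2 M N A \<le> K1 * h_pq p q M N A"
    using h_pq_le_h_pq[of p q 2 2] assms by auto
  obtain K2 where K2: "0 < K2" "\<And>M N A. h_pq p q M N A \<le> K2 * h_pq 2 2 M N A"
    using h_pq_le_h_pq[of 2 2 p q] assms by auto
  have "h_pq 2 2 M N A / max K1 K2 \<le> h_pq p q M N A \<and> h_pq p q M N A \<le> max K1 K2 * h_pq 2 2 M N A" for M N A
  proof -
    \<comment> \<open>Nonnegativity allows both constants to be enlarged to their maximum.\<close>
    have "0 \<le> h_pq 2 2 M N A" "0 \<le> h_pq p q M N A"
      using assms by (auto intro: h_pq_nonneg)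
    then have "K1 * h_pq p q M N A \<le> max K1 K2 * h_pq p q M N A"
      "K2 * h_pq 2 2 M N A \<le> max K1 K2 * h_pq 2 2 M N A"
      by (auto intro: mult_right_mono)
    then have "h_pq 2 2 M N A \<le> max K1 K2 * h_pq p q M N A" "h_pq p q M N A \<le> max K1 K2 * h_pq 2 2 M N A"
      using K1(2)[of M N A] K2(2)[of M N A] by linarith+
    then show ?thesis using K1(1) by (simp add: field_simps less_max_iff_disj)
  qed
  then show ?thesis unfolding h_const_def using K1(1)
    by (intro exI[of _ "max K1 K2"]) auto
qed

end
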